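(* Let $f:\mathbb{R}^n\to\mathbb{R}$ be a piecewise linear-quadratic (PLQ) function with polyhedral pieces $\{P^i\}_{i=1}^I$ (whose union is $\mathbb{R}^n$) and associated quadratic functions $\{q_i\}_{i=1}^I$, so that $f(x)=q_i(x)$ for all $x\in P^i$. Let $X\subseteq\mathbb{R}^n$ be a polyhedral set and let $\widetilde P^i\triangleq X\cap P^i$. Let $\bar x\in X$ and let $\mathcal{A}(\bar x)=\{i:\bar x\in P^i\}$. The following statements are all equivalent: (a1) $\bar x$ is a strong local minimizer of $f$ on $X$; (a2) $\bar x$ is a strict local minimizer of $f$ on $X$; (a3) $\bar x$ is an isolated local minimizer of $f$ on $X$; (a4) $\bar x$ is an isolated stationary point and a local minimizer of $f$ on $X$; (b1) for every $i\in\mathcal{A}(\bar x)$, $\bar x$ is a strong local minimizer of $f$ (or equivalently $q_i$) on $\widetilde P^i$; (b2) for every $i\in\mathcal{A}(\bar x)$, $\bar x$ is a strict local minimizer of $f$ (or equivalently $q_i$) on $\widetilde P^i$; (b3) for every $i\in\mathcal{A}(\bar x)$, $\bar x$ is an isolated local minimizer of $f$ (or equivalently $q_i$) on $\widetilde P^i$; (b4) for every $i\in\mathcal{A}(\bar x)$, $\bar x$ is an isolated stationary point and a local minimizer of $f$ (or equivalently $q_i$) on $\widetilde P^i$; (c) $\mathrm{d}f(\bar x)(x-\bar x)\ge0$ for all $x\in X$, and $\mathrm{d}^2f(\bar x)(x-\bar x)>0$ for all $x\in X\setminus\{\bar x\}$ with $\mathrm{d}f(\bar x)(x-\bar x)=0$;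 (d1) $\bar x$ is a directional stationary point of the problem of minimizing $f$ over $X$ and satisfies the second-order sufficient condition, i.e., $\mathrm{d}f(\bar x)(v)\ge 0$ for all $v\in\mathcal{T}(\bar x;X)$, and $\mathrm{d}^2f(\bar x)(v)>0$ for all nonzero $v\in\mathcal{T}(\bar x;X)$ such that $\mathrm{d}f(\bar x)(v)=0$; (d2) for every $i\in\mathcal{A}(\bar x)$, $\bar x$ is a stationary point of $q_i$ on $\widetilde P^i$ and $\nabla^2q_i(\bar x)$ is strictly copositive on $\mathcal{C}(\bar x;q_i;\widetilde P^i)$.
   Context: A continuous function $f:\mathcal{D}\to\mathbb{R}$, $\mathcal{D}\subseteq\mathbb{R}^n$, is piecewise linear-quadratic (PLQ) if there are finitely many quadratic functions $q_1,\dots,q_I$ (polynomials of degree at most 2) and polyhedra $P^1,\dots,P^I$ with union $\mathcal{D}$ such that $f=q_i$ on $P^i$. For a closed set $S$ and $\bar x\in S$, the tangent cone $\mathcal{T}(\bar x;S)$ is the set of all $v=\lim_k (x^k-\bar x)/\tau_k$ with $x^k\in S$, $x^k\to\bar x$, $\tau_k\downarrow 0$. Subderivatives: $\mathrm{d}f(x)(v)=\liminf_{v'\to v,\ \tau\downarrow0}\frac{f(x+\tau v')-f(x)}{\tau}$ and $\tfrac12\mathrm{d}^2f(x)(w)=\liminf_{w'\to w,\ \tau\downarrow0}\frac{f(x+\tau w')-f(x)-\tau\,\mathrm{d}f(x)(w')}{\tau^2}$. For a PLQ function on $\mathbb{R}^n$ these coincide, respectively, with the directional derivatives $f'(x;v)=\lim_{\tau\downarrow0}\frac{f(x+\tau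 v)-f(x)}{\tau}$ and $f^{(2)}(x;v)$, where $\tfrac12f^{(2)}(x;v)=\lim_{\tau\downarrow0}\frac{f(x+\tau v)-f(x)-\tau f'(x;v)}{\tau^2}$. Let $g$ be a function and $P$ a polyhedron, $\bar x\in P$. Then $\bar x$ is: a local minimizer of $g$ on $P$ if there is a neighborhood $\mathcal N$ of $\bar x$ with $g(x)\ge g(\bar x)$ for all $x\in P\cap\mathcal N$; a strict local minimizer if there is $\mathcal N$ with $g(x)>g(\bar x)$ for all $x\in P\cap\mathcal N$, $x\ne\bar x$; an isolated local minimizer if it is a local minimizer and there is $\mathcal N$ such that $\bar x$ is the only local minimizer of $g$ on $P$ lying in $\mathcal N$; a strong local minimizer if there are $c>0$ and $\mathcal N$ with $g(x)\ge g(\bar x)+c\|x-\bar x\|^2$ for all $x\in P\cap\mathcal N$; a (directional) stationary point of $g$ on $P$ if the one-sided directional derivative satisfies $g'(\bar x;v)\ge0$ for all $v\in\mathcal{T}(\bar x;P)$; an isolated stationary point if it is a stationary point and there is $\mathcal N$ such that $\bar x$ is the only stationary point of $g$ on $P$ in $\mathcal N$. When $f$ is considered on $\widetilde P^i$, directions are restricted to $\mathcal{T}(\cdot;\widetilde P^i)$, and $f=q_i$ there. For a quadratic function $q$, a polyhedron $P$ and $\bar x\in P$, the critical cone is $\mathcal{C}(\bar x;q;P)=\{v\in\mathcal{T}(\bar x;P):\nabla q(\bar x)^Tv=0\}$. A symmetric matrix $M$ is strictly copositive on a cone $C$ if $v^TMv>0$ for all nonzero $v\in C$. *)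

theory Defs
  imports "HOL-Analysis.Analysis"
begin

definition quadratic_function :: "(real^'n \<Rightarrow> real) \<Rightarrow> bool" where
  "quadratic_function q \<longleftrightarrow>
     (\<exists>(A :: real^'n^'n) b c. \<forall>x. q x = x \<bullet> (A *v x) + b \<bullet> x + c)"

definition PLQ_on ::
  "(real^'n) set \<Rightarrow> (real^'n \<Rightarrow> real) \<Rightarrow> nat \<Rightarrow> (nat \<Rightarrow> (real^'n) set) \<Rightarrow>
    (nat \<Rightarrow> real^'n \<Rightarrow> real) \<Rightarrow> bool" where
  "PLQ_on D f I P q \<longleftrightarrow>
     continuous_on D f \<and>
     (\<Union>i\<in>{1..I}. P i) = D \<and>
     (\<forall>i\<in>{1..I}. polyhedron (P i) \<and> quadratic_function (q i) \<and> (\<forall>x\<in>P i. f x = q i x))"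

definition active_pieces :: "nat \<Rightarrow> (nat \<Rightarrow> 'a set) \<Rightarrow> 'a \<Rightarrow> nat set" where
  "active_pieces I P x = {i \<in> {1..I}. x \<in> P i}"

definition tangent_cone :: "'a::real_normed_vector \<Rightarrow> 'a set \<Rightarrow> 'a set" where
  "tangent_cone x S =
     {v. \<exists>y \<tau>. (\<forall>k::nat. y k \<in> S) \<and> y \<longlonglongrightarrow> x \<and>
           filterlim \<tau> (at_right (0::real)) sequentially \<and>
           (\<lambda>k. (y k - x) /\<^sub>R \<tau> k) \<longlonglongrightarrow> v}"

definition has_dir_derivative ::
  "('a::real_normed_vector \<Rightarrow> real) \<Rightarrow> 'a \<Rightarrow> 'a \<Rightarrow> real \<Rightarrow> bool" where
  "has_dir_derivative f x v d \<longleftrightarrow>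
     ((\<lambda>\<tau>. (f (x + \<tau> *\<^sub>R v) - f x) / \<tau>) \<longlongrightarrow> d) (at_right 0)"

definition subderivative :: "('a::real_normed_vector \<Rightarrow> real) \<Rightarrow> 'a \<Rightarrow> 'a \<Rightarrow> ereal" where
  "subderivative f x v =
     Liminf (nhds v \<times>\<^sub>F at_right 0)
       (\<lambda>(v', \<tau>). ereal ((f (x + \<tau> *\<^sub>R v') - f x) / \<tau>))"

text \<open>The lower limit below is one half of the second subderivative, as the quotient
  is formed with \<open>\<tau>\<^sup>2\<close> and not with \<open>\<tau>\<^sup>2 / 2\<close>.\<close>

definition second_subderivative ::
  "('a::real_normed_vector \<Rightarrow> real) \<Rightarrow> 'a \<Rightarrow> 'a \<Rightarrow> ereal" where
  "second_subderivative f x w =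
     2 * Liminf (nhds w \<times>\<^sub>F at_right 0)
       (\<lambda>(w', \<tau>). (ereal (f (x + \<tau> *\<^sub>R w') - f x) - ereal \<tau> * subderivative f x w')
                     / ereal (\<tau>\<^sup>2))"

definition gradient :: "('a::real_inner \<Rightarrow> real) \<Rightarrow> 'a \<Rightarrow> 'a" where
  "gradient q x = (THE D. GDERIV q x :> D)"

definition hessian :: "(real^'n \<Rightarrow> real) \<Rightarrow> real^'n \<Rightarrow> real^'n^'n" where
  "hessian q x = jacobian (gradient q) (at x)"

definition critical_cone :: "'a::real_inner \<Rightarrow> ('a \<Rightarrow> real) \<Rightarrow> 'a set \<Rightarrow> 'a set" where
  "critical_cone x q P = {v \<in> tangent_cone x P. gradient q x \<bullet> v = 0}"

definition strictly_copositive_on :: "real^'n^'n \<Rightarrow> (real^'n) set \<Rightarrow> bool" where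
  "strictly_copositive_on M C \<longleftrightarrow>
     transpose M = M \<and> (\<forall>v\<in>C. v \<noteq> 0 \<longrightarrow> v \<bullet> (M *v v) > 0)"

definition local_minimizer :: "('a::real_normed_vector \<Rightarrow> real) \<Rightarrow> 'a set \<Rightarrow> 'a \<Rightarrow> bool" where
  "local_minimizer g P x \<longleftrightarrow>
     x \<in> P \<and> (\<exists>N. open N \<and> x \<in> N \<and> (\<forall>y\<in>P \<inter> N. g y \<ge> g x))"

definition strict_local_minimizer ::
  "('a::real_normed_vector \<Rightarrow> real) \<Rightarrow> 'a set \<Rightarrow> 'a \<Rightarrow> bool" where
  "strict_local_minimizer g P x \<longleftrightarrow>
     x \<in> P \<and> (\<exists>N. open N \<and> x \<in> N \<and> (\<forall>y\<in>P \<inter> N. y \<noteq> x \<longrightarrow> g y > g x))"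

definition isolated_local_minimizer ::
  "('a::real_normed_vector \<Rightarrow> real) \<Rightarrow> 'a set \<Rightarrow> 'a \<Rightarrow> bool" where
  "isolated_local_minimizer g P x \<longleftrightarrow>
     local_minimizer g P x \<and>
     (\<exists>N. open N \<and> x \<in> N \<and> (\<forall>y\<in>N. local_minimizer g P y \<longrightarrow> y = x))"

definition strong_local_minimizer ::
  "('a::real_normed_vector \<Rightarrow> real) \<Rightarrow> 'a set \<Rightarrow> 'a \<Rightarrow> bool" where
  "strong_local_minimizer g P x \<longleftrightarrow>
     x \<in> P \<and>
     (\<exists>c>0. \<exists>N. open N \<and> x \<in> N \<and> (\<forall>y\<in>P \<inter> N. g y \<ge> g x + c * (norm (y - x))\<^sup>2))"

text \<open>The one-sided directional derivatives are required to exist in every tangent direction.\<close>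

definition stationary_point :: "('a::real_normed_vector \<Rightarrow> real) \<Rightarrow> 'a set \<Rightarrow> 'a \<Rightarrow> bool" where
  "stationary_point g P x \<longleftrightarrow>
     x \<in> P \<and> (\<forall>v\<in>tangent_cone x P. \<exists>d\<ge>0. has_dir_derivative g x v d)"

definition isolated_stationary_point ::
  "('a::real_normed_vector \<Rightarrow> real) \<Rightarrow> 'a set \<Rightarrow> 'a \<Rightarrow> bool" where
  "isolated_stationary_point g P x \<longleftrightarrow>
     stationary_point g P x \<and>
     (\<exists>N. open N \<and> x \<in> N \<and> (\<forall>y\<in>N. stationary_point g P y \<longrightarrow> y = x))"

definition all_equivalent :: "bool list \<Rightarrow> bool" where
  "all_equivalent ps \<longleftrightarrow> (\<forall>p\<in>set ps. \<forall>p'\<in>set ps. p \<longleftrightarrow> p')"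

end

theory Submission
  imports Defs
begin

text \<open>Near any point a PLQ function has an exact expansion \<open>f (x + u) = f x + h u + Q u\<close>
  with \<open>h\<close>, \<open>Q\<close> continuous and positively homogeneous of degrees 1 and 2, glued from the gradients
  and Hessians of the active pieces along their tangent cones; \<open>h\<close> and \<open>2 * Q\<close> are then the first and
  second subderivatives. Polyhedra coincide near a point with their tangent cone, so each statement
  reduces to: \<open>h \<ge> 0\<close> on the tangent cone, and \<open>Q > 0\<close> at its nonzero points where \<open>h = 0\<close>.
  Compactness of the unit sphere turns this condition into quadratic growth. A single quadratic is
  itself PLQ, and the tangent cone of \<open>X\<close> is the union of those of \<open>X \<inter> P i\<close>, which handles
  the statements about pieces.\<close>

section \<open>From neighbourhoods of the origin to short rays\<close>

lemma eventually_nhds_0_ray: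
  fixes v :: "'a::real_normed_vector"
  assumes "eventually R (nhds (0::'a))"
  shows "\<forall>\<^sub>F t in at_right (0::real). R (t *\<^sub>R v)"
proof -
  have "((\<lambda>t::real. t *\<^sub>R v) \<longlongrightarrow> 0 *\<^sub>R v) (at_right 0)"
    by (intro tendsto_intros)
  then have "filterlim (\<lambda>t::real. t *\<^sub>R v) (nhds 0) (at_right 0)" by simp
  then show ?thesis using assms by (rule eventually_compose_filterlim[rotated])
qed

lemma eventually_at_right_0_witness:
  assumes "\<forall>\<^sub>F t in at_right (0::real). R t"
  obtains t where "t > 0" "R t"
proof -
  obtain b where "b > 0" "\<And>y. 0 < y \<Longrightarrow> y < b \<Longrightarrow> R y"
    using assms unfolding eventually_at_right_field by blast
  then show ?thesis using that[of "b/2"] by simp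
qed

section \<open>Local conic structure and tangent cones of polyhedra\<close>

text \<open>Each defining half-space is treated separately. A constraint active at \<open>x\<close>
  contributes its homogeneous half-space, while an inactive one holds throughout a neighbourhood and
  contributes \<open>UNIV\<close>. Finiteness allows the neighbourhoods to be intersected.\<close>

lemma polyhedron_locally_conic:
  fixes S :: "'a::euclidean_space set"
  assumes "polyhedron S" "x \<in> S"
  shows "\<exists>K. closed K \<and> cone K \<and> (\<forall>\<^sub>F u in nhds 0. x + u \<in> S \<longleftrightarrow> u \<in> K)"
proof -
  obtain F where F: "finite F" "S = \<Inter>F"
    "\<forall>h\<in>F. \<exists>a b. a \<noteq> 0 \<and> h = {x. a \<bullet> x \<le> b}"
    using assms(1) unfolding polyhedron_def by blast
  have half: "\<exists>K. closed K \<and> cone K \<and> (\<forall>\<^sub>F u in nhds 0. x + u \<in> h \<longleftrightarrow> u \<in> K)"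
    if hF: "h \<in> F" for h
  proof -
    obtain a b where h: "h = {x. a \<bullet> x \<le> b}" using F(3) hF by blast
    have ax: "a \<bullet> x \<le> b" using assms(2) F(2) hF h by blast
    show ?thesis
    proof (cases "a \<bullet> x = b")
      case True
      have "cone {u. a \<bullet> u \<le> 0}"
        by (auto simp: cone_def intro: mult_nonneg_nonpos)
      moreover have "x + u \<in> h \<longleftrightarrow> u \<in> {u. a \<bullet> u \<le> 0}" for u
        using True h by (simp add: inner_add_right)
      ultimately show ?thesis
        using closed_halfspace_le[of a 0] by (intro exI[of _ "{u. a \<bullet> u \<le> 0}"]) simp
    next
      case False
      have "((\<lambda>u. a \<bullet> (x + u)) \<longlongrightarrow> a \<bullet> (x + 0)) (nhds 0)"
        by (intro tendsto_intros filterlim_ident)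
      then have "\<forall>\<^sub>F u in nhds 0. a \<bullet> (x + u) < b"
        using False ax by (intro order_tendstoD) auto
      then have "\<forall>\<^sub>F u in nhds 0. x + u \<in> h \<longleftrightarrow> u \<in> UNIV"
        by eventually_elim (simp add: h)
      then show ?thesis by (intro exI[of _ UNIV]) simp
    qed
  qed
  then obtain K where K: "\<And>h. h \<in> F \<Longrightarrow> closed (K h)" "\<And>h. h \<in> F \<Longrightarrow> cone (K h)"
    "\<And>h. h \<in> F \<Longrightarrow> \<forall>\<^sub>F u in nhds 0. x + u \<in> h \<longleftrightarrow> u \<in> K h" by metis
  have "\<forall>\<^sub>F u in nhds 0. \<forall>h\<in>F. x + u \<in> h \<longleftrightarrow> u \<in> K h"
    using K(3) F(1) by (intro eventually_ball_finite) auto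
  then have "\<forall>\<^sub>F u in nhds 0. x + u \<in> S \<longleftrightarrow> u \<in> (\<Inter>h\<in>F. K h)"
    by eventually_elim (simp add: F(2))
  moreover have "closed (\<Inter>h\<in>F. K h)" using K(1) by blast
  moreover have "cone (\<Inter>h\<in>F. K h)" using K(2) unfolding cone_def by blast
  ultimately show ?thesis by blast
qed

lemma cone_iff_ray:
  assumes "cone K" "t > 0"
  shows "t *\<^sub>R v \<in> K \<longleftrightarrow> v \<in> K"
proof
  assume "t *\<^sub>R v \<in> K"
  moreover have "0 \<le> 1 / t" using assms(2) by simp
  ultimately have "(1/t) *\<^sub>R (t *\<^sub>R v) \<in> K" using assms(1) unfolding cone_def by blast
  then show "v \<in> K" using assms by simp
qed (use assms in \<open>auto simp: cone_def\<close>)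

text \<open>Difference quotients of a sequence in \<open>S\<close> eventually lie in
  \<open>K\<close> by scaling, and closedness keeps the limit there. Conversely, a ray of
  \<open>K\<close> starts inside \<open>x + K\<close> and hence in \<open>S\<close>, with constant
  quotients. Later tangent cones can therefore be identified without sequences.\<close>

lemma tangent_cone_eq_if_locally_conic:
  assumes "closed K" "cone K" and ev: "\<forall>\<^sub>F u in nhds 0. x + u \<in> S \<longleftrightarrow> u \<in> K"
  shows "tangent_cone x S = K"
proof (intro set_eqI iffI)
  fix v assume "v \<in> tangent_cone x S"
  then obtain y \<tau> where y: "\<And>k::nat. y k \<in> S" "y \<longlonglongrightarrow> x"
    and \<tau>: "filterlim \<tau> (at_right (0::real)) sequentially"
    and lim: "(\<lambda>k. (y k - x) /\<^sub>R \<tau> k) \<longlonglongrightarrow> v" unfolding tangent_cone_def by blast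
  have "(\<lambda>k. y k - x) \<longlonglongrightarrow> 0" using y(2) by (simp add: LIM_zero)
  then have "\<forall>\<^sub>F k in sequentially. x + (y k - x) \<in> S \<longleftrightarrow> y k - x \<in> K"
    using ev by (rule eventually_compose_filterlim[rotated])
  moreover have "\<forall>\<^sub>F k in sequentially. \<tau> k > 0"
    using \<tau> by (auto simp: filterlim_at elim: eventually_mono)
  ultimately have "\<forall>\<^sub>F k in sequentially. (y k - x) /\<^sub>R \<tau> k \<in> K"
  proof eventually_elim
    case (elim k)
    then have "y k - x \<in> K" using y(1) by simp
    then show ?case using elim(2) assms(2) by (subst cone_iff_ray) auto
  qed
  then show "v \<in> K" using assms(1) lim Lim_in_closed_set by (metis sequentially_bot)
next
  fix v assume v: "v \<in> K"
  have "\<forall>\<^sub>F t in at_right 0. x + t *\<^sub>R v \<in> S"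
    using eventually_nhds_0_ray[OF ev, of v] eventually_at_right_less[of 0]
    by eventually_elim (use v assms(2) in \<open>simp add: cone_iff_ray\<close>)
  then obtain b where b: "b > 0" "\<And>t. 0 < t \<Longrightarrow> t < b \<Longrightarrow> x + t *\<^sub>R v \<in> S"
    unfolding eventually_at_right_field by blast
  \<comment> \<open>The definition of \<open>tangent_cone\<close> asks for membership in
    \<open>S\<close> at every index, so all step sizes, from the first one on, stay below
    \<open>b\<close>.\<close>
  define \<tau> where "\<tau> = (\<lambda>k::nat. b / 2 * inverse (real (Suc k)))"
  have pos: "\<tau> k > 0" for k using b(1) by (simp add: \<tau>_def)
  have "\<tau> k \<le> b / 2 * 1" for k
    unfolding \<tau>_def using b(1) by (intro mult_left_mono) (auto simp: inverse_le_1_iff)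
  then have less: "\<tau> k < b" for k using b(1) by (smt (verit) field_sum_of_halves)
  have "\<tau> \<longlonglongrightarrow> b / 2 * 0" unfolding \<tau>_def
    by (intro tendsto_mult tendsto_const LIMSEQ_inverse_real_of_nat)
  then have \<tau>0: "\<tau> \<longlonglongrightarrow> 0" by simp
  then have "filterlim \<tau> (at_right 0) sequentially"
    using pos by (intro tendsto_imp_filterlim_at_right) auto
  moreover have "(\<lambda>k. x + \<tau> k *\<^sub>R v) \<longlonglongrightarrow> x + 0 *\<^sub>R v" using \<tau>0 by (intro tendsto_intros)
  moreover have "(x + \<tau> k *\<^sub>R v - x) /\<^sub>R \<tau> k = v" for k using pos[of k] by simp
  ultimately show "v \<in> tangent_cone x S"
    unfolding tangent_cone_def using b(2)[OF pos less]
    by (intro CollectI exI[of _ "\<lambda>k. x + \<tau> k *\<^sub>R v"] exI[of _ \<tau>]) simp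
qed

context
  fixes S :: "'a::euclidean_space set" and x :: 'a
  assumes S: "polyhedron S" "x \<in> S"
begin

lemma closed_tangent_cone: "closed (tangent_cone x S)"
  and cone_tangent_cone: "cone (tangent_cone x S)"
  and eventually_tangent_cone_iff: "\<forall>\<^sub>F u in nhds 0. x + u \<in> S \<longleftrightarrow> u \<in> tangent_cone x S"
  using polyhedron_locally_conic[OF S] tangent_cone_eq_if_locally_conic by metis+

lemma eventually_ray_in_polyhedron:
  assumes "v \<in> tangent_cone x S"
  shows "\<forall>\<^sub>F t in at_right 0. x + t *\<^sub>R v \<in> S"
  using eventually_nhds_0_ray[OF eventually_tangent_cone_iff, of v] eventually_at_right_less[of 0]
  by eventually_elim (use assms cone_tangent_cone in \<open>simp add: cone_iff_ray\<close>)

text \<open>Here \<open>y\<close> may be far from \<open>x\<close>: convexity brings a short initial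
  piece of the segment into \<open>S\<close>, the local description applies to that piece, and
  scaling recovers the full difference.\<close>

lemma diff_in_tangent_cone:
  assumes "y \<in> S"
  shows "y - x \<in> tangent_cone x S"
proof -
  have lt1: "\<forall>\<^sub>F t in at_right (0::real). t < 1"
    by (rule order_tendstoD(2)[OF tendsto_ident_at]) simp
  obtain t where t: "t > 0" "t < 1"
    "x + t *\<^sub>R (y - x) \<in> S \<longleftrightarrow> t *\<^sub>R (y - x) \<in> tangent_cone x S"
    using eventually_at_right_0_witness[OF eventually_conj[OF lt1
        eventually_nhds_0_ray[OF eventually_tangent_cone_iff, of "y - x"]]] by blast
  have "(1 - t) *\<^sub>R x + t *\<^sub>R y \<in> S"
    using S assms t by (intro convexD polyhedron_imp_convex) auto
  moreover have "(1 - t) *\<^sub>R x + t *\<^sub>R y = x + t *\<^sub>R (y - x)" by (simp add: algebra_simps)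
  ultimately have "t *\<^sub>R (y - x) \<in> tangent_cone x S" using t by simp
  then show ?thesis using t(1) cone_iff_ray[OF cone_tangent_cone] by blast
qed

end

text \<open>For general sets only the inclusion from left to right holds. For polyhedra the two
  local conic descriptions can simply be intersected.\<close>

lemma tangent_cone_Int_polyhedron:
  fixes S :: "'a::euclidean_space set"
  assumes "polyhedron S" "x \<in> S" "polyhedron S'" "x \<in> S'"
  shows "tangent_cone x (S \<inter> S') = tangent_cone x S \<inter> tangent_cone x S'"
proof (rule tangent_cone_eq_if_locally_conic)
  show "closed (tangent_cone x S \<inter> tangent_cone x S')"
    using assms by (intro closed_Int closed_tangent_cone)
  show "cone (tangent_cone x S \<inter> tangent_cone x S')"
    using assms cone_tangent_cone unfolding cone_def by blast
  show "\<forall>\<^sub>F u in nhds 0. (x + u \<in> S \<inter> S') \<longleftrightarrow> (u \<in> tangent_cone x S \<inter> tangent_cone x S')"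
    using eventually_tangent_cone_iff[OF assms(1,2)] eventually_tangent_cone_iff[OF assms(3,4)]
    by eventually_elim simp
qed

section \<open>Exact first and second order expansions and the subderivatives they determine\<close>

text \<open>Linearity of \<open>h\<close> and quadraticity of \<open>Q\<close> would be too strong,
  since at a kink both are glued from different pieces. Continuity and positive homogeneity survive
  the gluing.\<close>

definition lq_expansion ::
  "('a::real_normed_vector \<Rightarrow> real) \<Rightarrow> 'a \<Rightarrow> ('a \<Rightarrow> real) \<Rightarrow> ('a \<Rightarrow> real) \<Rightarrow> bool" where
  "lq_expansion f x h Q \<longleftrightarrow>
     continuous_on UNIV h \<and> continuous_on UNIV Q \<and>
     (\<forall>t>0. \<forall>v. h (t *\<^sub>R v) = t * h v) \<and> (\<forall>t>0. \<forall>v. Q (t *\<^sub>R v) = t\<^sup>2 * Q v) \<and>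
     (\<forall>\<^sub>F u in nhds 0. f (x + u) = f x + h u + Q u)"

text \<open>Division by \<open>t\<close> leaves affine functions, which two sample points determine.
  This is what makes overlapping pieces agree.\<close>

lemma lq_coefficients_unique:
  fixes a b a' b' :: real
  assumes "\<forall>\<^sub>F t in at_right 0. t * a + t\<^sup>2 * b = t * a' + t\<^sup>2 * b'"
  shows "a = a'" "b = b'"
proof -
  obtain e where e: "e > 0" "\<And>t. 0 < t \<Longrightarrow> t < e \<Longrightarrow> t * a + t\<^sup>2 * b = t * a' + t\<^sup>2 * b'"
    using assms unfolding eventually_at_right_field by blast
  have *: "a + t * b = a' + t * b'" if "0 < t" "t < e" for t
  proof -
    have "t * (a + t * b) = t * (a' + t * b')"
      using e(2)[OF that] by (simp add: power2_eq_square algebra_simps)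
    then show ?thesis using that by simp
  qed
  have "a + e/2 * b = a' + e/2 * b'" "a + e/4 * b = a' + e/4 * b'"
    using *[of "e/2"] *[of "e/4"] e(1) by simp_all
  then have "e/4 * b = e/4 * b'" by argo
  then show "b = b'" using e(1) by simp
  with *[of "e/2"] e(1) show "a = a'" by simp
qed

lemma snd_tendsto_0: "(snd \<longlongrightarrow> 0) (F \<times>\<^sub>F at_right (0::real))"
proof -
  have "filterlim snd (at_right (0::real)) (F \<times>\<^sub>F at_right 0)" by (rule filterlim_snd)
  then show ?thesis by (simp add: filterlim_at)
qed

context
  fixes f :: "'a::real_normed_vector \<Rightarrow> real" and x :: 'a and h Q :: "'a \<Rightarrow> real"
  assumes lq: "lq_expansion f x h Q"
begin

lemma lq_expansion_ray:
  "\<forall>\<^sub>F t in at_right 0. f (x + t *\<^sub>R v) = f x + (t * h v + t\<^sup>2 * Q v)"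
proof -
  have "\<forall>\<^sub>F t in at_right 0. f (x + t *\<^sub>R v) = f x + h (t *\<^sub>R v) + Q (t *\<^sub>R v)"
    using lq unfolding lq_expansion_def by (intro eventually_nhds_0_ray) simp
  then show ?thesis using eventually_at_right_less[of 0]
    by eventually_elim (use lq in \<open>simp add: lq_expansion_def\<close>)
qed

lemma lq_expansion_zero: "h 0 = 0" "Q 0 = 0"
proof -
  have "h (2 *\<^sub>R 0) = 2 * h 0" "Q (2 *\<^sub>R 0) = 2\<^sup>2 * Q 0"
    using lq zero_less_numeral unfolding lq_expansion_def by blast+
  then show "h 0 = 0" "Q 0 = 0" by auto
qed

lemma has_dir_derivative_lq: "has_dir_derivative f x v (h v)"
proof -
  have "((\<lambda>t. h v + t * Q v) \<longlongrightarrow> h v + 0 * Q v) (at_right 0)" by (intro tendsto_intros)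
  moreover have "\<forall>\<^sub>F t in at_right 0. h v + t * Q v = (f (x + t *\<^sub>R v) - f x) / t"
    using lq_expansion_ray[of v] eventually_at_right_less[of 0]
    by eventually_elim (simp add: field_simps power2_eq_square)
  ultimately show ?thesis unfolding has_dir_derivative_def
    using Lim_transform_eventually by fastforce
qed

text \<open>Both subderivatives let the direction vary together with the step. The product of step
  and direction still tends to 0, so the expansion applies along the product filter.\<close>

lemma eventually_lq_quotient:
  "\<forall>\<^sub>F (w, t) in nhds v \<times>\<^sub>F at_right 0. t > 0 \<and> f (x + t *\<^sub>R w) = f x + (t * h w + t\<^sup>2 * Q w)"
proof -
  let ?F = "nhds v \<times>\<^sub>F at_right (0::real)"
  have "((\<lambda>p. snd p *\<^sub>R fst p) \<longlongrightarrow> 0 *\<^sub>R v) ?F"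
    by (intro tendsto_scaleR filterlim_fst snd_tendsto_0)
  then have "filterlim (\<lambda>p. snd p *\<^sub>R fst p) (nhds 0) ?F" by simp
  moreover have "\<forall>\<^sub>F u in nhds 0. f (x + u) = f x + h u + Q u"
    using lq unfolding lq_expansion_def by simp
  ultimately have "\<forall>\<^sub>F p in ?F. f (x + snd p *\<^sub>R fst p) =
      f x + h (snd p *\<^sub>R fst p) + Q (snd p *\<^sub>R fst p)"
    by (rule eventually_compose_filterlim[rotated])
  moreover have "\<forall>\<^sub>F p in ?F. snd p > 0"
    using filterlim_snd eventually_at_right_less[of "0::real"]
    by (rule eventually_compose_filterlim[rotated])
  ultimately show ?thesis
    by eventually_elim (use lq in \<open>auto simp: lq_expansion_def\<close>)
qed

lemma nontrivial_nhds_prod_at_right: "nhds (v::'a) \<times>\<^sub>F at_right (0::real) \<noteq> bot"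
  by (simp add: prod_filter_eq_bot)

text \<open>The quotient is eventually \<open>h w + t * Q w\<close>, which converges by continuity
  of \<open>h\<close> and \<open>Q\<close>; the lower limit is thus a limit.\<close>

lemma subderivative_lq: "subderivative f x v = ereal (h v)"
proof -
  let ?F = "nhds v \<times>\<^sub>F at_right (0::real)"
  have c: "isCont h v" "isCont Q v"
    using lq unfolding lq_expansion_def by (auto simp: continuous_on_eq_continuous_at)
  have "filterlim fst (nhds v) ?F" by (rule filterlim_fst)
  then have 1: "((\<lambda>p. h (fst p)) \<longlongrightarrow> h v) ?F" "((\<lambda>p. Q (fst p)) \<longlongrightarrow> Q v) ?F"
    using c by (auto intro: isCont_tendsto_compose)
  have "((\<lambda>p. h (fst p) + snd p * Q (fst p)) \<longlongrightarrow> h v + 0 * Q v) ?F"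
    by (intro tendsto_intros 1 snd_tendsto_0)
  then have "((\<lambda>p. ereal (h (fst p) + snd p * Q (fst p))) \<longlongrightarrow> ereal (h v)) ?F" by simp
  moreover have "\<forall>\<^sub>F p in ?F. ereal (h (fst p) + snd p * Q (fst p)) =
      (\<lambda>(w, t). ereal ((f (x + t *\<^sub>R w) - f x) / t)) p"
    using eventually_lq_quotient[of v]
    by eventually_elim (auto simp: field_simps power2_eq_square)
  ultimately have "((\<lambda>(w, t). ereal ((f (x + t *\<^sub>R w) - f x) / t)) \<longlongrightarrow> ereal (h v)) ?F"
    by (rule Lim_transform_eventually)
  then show ?thesis unfolding subderivative_def
    by (intro lim_imp_Liminf nontrivial_nhds_prod_at_right)
qed

text \<open>The subtracted subderivative is taken in the moving direction \<open>w\<close> and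
  cancels \<open>h w\<close> exactly, leaving the continuous function \<open>Q\<close>.\<close>

lemma second_subderivative_lq: "second_subderivative f x v = ereal (2 * Q v)"
proof -
  let ?F = "nhds v \<times>\<^sub>F at_right (0::real)"
  let ?g = "\<lambda>(w, t). (ereal (f (x + t *\<^sub>R w) - f x) - ereal t * subderivative f x w) / ereal (t\<^sup>2)"
  have "isCont Q v"
    using lq unfolding lq_expansion_def by (auto simp: continuous_on_eq_continuous_at)
  then have "((\<lambda>p. Q (fst p)) \<longlongrightarrow> Q v) ?F"
    using filterlim_fst by (rule isCont_tendsto_compose)
  then have "((\<lambda>p. ereal (Q (fst p))) \<longlongrightarrow> ereal (Q v)) ?F" by simp
  moreover have "\<forall>\<^sub>F p in ?F. ereal (Q (fst p)) = ?g p"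
    using eventually_lq_quotient[of v]
    by eventually_elim (auto simp: subderivative_lq field_simps)
  ultimately have "(?g \<longlongrightarrow> ereal (Q v)) ?F" by (rule Lim_transform_eventually)
  then have "Liminf ?F ?g = ereal (Q v)"
    by (intro lim_imp_Liminf nontrivial_nhds_prod_at_right)
  then show ?thesis unfolding second_subderivative_def by simp
qed

end

section \<open>Gradient, Hessian and Taylor formula of a quadratic function\<close>

text \<open>The matrix \<open>A\<close> in the representation of \<open>q\<close> may fail to be
  symmetric, so the Hessian is \<open>A + transpose A\<close>. Its quadratic form is twice that of
  \<open>A\<close>, which accounts for the factor 1/2.\<close>

lemma quadratic_function_derivatives:
  fixes q :: "real^'n \<Rightarrow> real"
  assumes "quadratic_function q"
  shows transpose_hessian_quadratic: "transpose (hessian q x) = hessian q x"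
    and quadratic_taylor:
      "q (x + u) = q x + gradient q x \<bullet> u + 1/2 * (u \<bullet> (hessian q x *v u))"
proof -
  obtain A :: "real^'n^'n" and b c where q: "\<And>x. q x = x \<bullet> (A *v x) + b \<bullet> x + c"
    using assms unfolding quadratic_function_def by blast
  have sym: "u \<bullet> (A *v v) = v \<bullet> (transpose A *v u)" for u v
    by (metis dot_lmul_matrix inner_commute transpose_matrix_vector)
  have deriv: "GDERIV q y :> (A + transpose A) *v y + b" for y
  proof -
    have "((\<lambda>x. x \<bullet> (A *v x) + b \<bullet> x + c) has_derivative
        (\<lambda>h. y \<bullet> (A *v h) + h \<bullet> (A *v y) + b \<bullet> h + 0)) (at y)"
      by (intro derivative_intros bounded_linear_imp_has_derivative
          linear_conv_bounded_linear[THEN iffD1] matrix_vector_mul_linear)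
    moreover have "y \<bullet> (A *v h) + h \<bullet> (A *v y) + b \<bullet> h + 0 =
        h \<bullet> ((A + transpose A) *v y + b)" for h
      using sym[of y h]
      by (simp add: matrix_vector_mult_add_rdistrib inner_add_right inner_commute)
    ultimately show ?thesis unfolding gderiv_def q by simp
  qed
  \<comment> \<open>\<open>gradient\<close> is a definite description, so uniqueness is required; it
    follows by testing both derivatives on \<open>D - D'\<close>.\<close>
  have unique: "D = D'" if "GDERIV q y :> D" "GDERIV q y :> D'" for D D' y
  proof -
    have "(\<lambda>h. h \<bullet> D) = (\<lambda>h. h \<bullet> D')"
      using that unfolding gderiv_def by (rule has_derivative_unique)
    then have "(D - D') \<bullet> D = (D - D') \<bullet> D'" by (rule fun_cong)
    then have "(D - D') \<bullet> (D - D') = 0" by (simp add: inner_diff_right)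
    then show ?thesis by simp
  qed
  have grad: "gradient q = (\<lambda>y. (A + transpose A) *v y + b)"
    unfolding gradient_def by (rule ext, rule the_equality, rule deriv, erule unique[OF _ deriv])
  have "(gradient q has_derivative (\<lambda>h. (A + transpose A) *v h + 0)) (at x)"
    unfolding grad by (intro derivative_intros bounded_linear_imp_has_derivative
          linear_conv_bounded_linear[THEN iffD1] matrix_vector_mul_linear)
  then have "frechet_derivative (gradient q) (at x) = (\<lambda>h. (A + transpose A) *v h)"
    by (simp add: frechet_derivative_at[symmetric])
  then have hess: "hessian q x = A + transpose A"
    unfolding hessian_def jacobian_def by simp
  show "transpose (hessian q x) = hessian q x"
    unfolding hess by (simp add: transpose_def vec_eq_iff)
  have "u \<bullet> (hessian q x *v u) = 2 * (u \<bullet> (A *v u))"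
    using sym[of u u] by (simp add: hess matrix_vector_mult_add_rdistrib inner_add_right)
  moreover have "gradient q x \<bullet> u = x \<bullet> (A *v u) + u \<bullet> (A *v x) + b \<bullet> u"
    using sym[of x u] by (simp add: grad matrix_vector_mult_add_rdistrib inner_add_left inner_add_right
        inner_commute)
  ultimately show "q (x + u) = q x + gradient q x \<bullet> u + 1/2 * (u \<bullet> (hessian q x *v u))"
    by (simp add: q matrix_vector_right_distrib inner_add_left inner_add_right)
qed

lemma lq_expansion_quadratic:
  assumes "quadratic_function q"
  shows "lq_expansion q x (\<lambda>v. gradient q x \<bullet> v) (\<lambda>v. 1/2 * (v \<bullet> (hessian q x *v v)))"
proof -
  have "continuous_on UNIV (\<lambda>v. hessian q x *v v)"
    by (intro linear_continuous_on linear_conv_bounded_linear[THEN iffD1] matrix_vector_mul_linear)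
  then show ?thesis
    unfolding lq_expansion_def using quadratic_taylor[OF assms, of x]
    by (auto intro!: continuous_intros
        simp: matrix_vector_mult_scaleR power2_eq_square)
qed

section \<open>Gluing the expansions of the active pieces\<close>

text \<open>The tangent cones of the active pieces are finitely many closed cones covering the
  space. On an overlap the quadratic pieces have equal coefficients, since both describe
  \<open>f\<close> there, so pasting yields continuous \<open>h\<close> and
  \<open>Q\<close>.\<close>

lemma PLQ_lq_expansion:
  fixes f :: "real^'n \<Rightarrow> real"
  assumes PLQ: "PLQ_on UNIV f I P q"
  obtains h Q where "lq_expansion f x h Q"
    "\<forall>i\<in>active_pieces I P x. \<forall>v\<in>tangent_cone x (P i).
       h v = gradient (q i) x \<bullet> v \<and> Q v = 1/2 * (v \<bullet> (hessian (q i) x *v v))"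
    "\<forall>v. \<exists>i\<in>active_pieces I P x. v \<in> tangent_cone x (P i)"
proof -
  define A where "A = active_pieces I P x"
  define K where "K = (\<lambda>i. tangent_cone x (P i))"
  define g where "g = (\<lambda>i v. gradient (q i) x \<bullet> v)"
  define H where "H = (\<lambda>i v. 1/2 * (v \<bullet> (hessian (q i) x *v v)))"
  have cover: "(\<Union>i\<in>{1..I}. P i) = UNIV"
    and poly: "\<And>i. i \<in> {1..I} \<Longrightarrow> polyhedron (P i)"
    and quad: "\<And>i. i \<in> {1..I} \<Longrightarrow> quadratic_function (q i)"
    and fq: "\<And>i x. i \<in> {1..I} \<Longrightarrow> x \<in> P i \<Longrightarrow> f x = q i x"
    using PLQ unfolding PLQ_on_def by auto
  have A: "i \<in> {1..I}" "x \<in> P i" if "i \<in> A" for i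
    using that by (auto simp: A_def active_pieces_def)
  have finA: "finite A" by (simp add: A_def active_pieces_def)
  have K: "closed (K i)" "cone (K i)" "\<forall>\<^sub>F u in nhds 0. x + u \<in> P i \<longleftrightarrow> u \<in> K i"
    if "i \<in> A" for i
    unfolding K_def using A[OF that] poly
    by (auto intro: closed_tangent_cone cone_tangent_cone eventually_tangent_cone_iff)
  have lq: "lq_expansion (q i) x (g i) (H i)" if "i \<in> A" for i
    unfolding g_def H_def using lq_expansion_quadratic quad A[OF that] by blast
  have ev_q: "\<forall>\<^sub>F u in nhds 0. \<forall>i\<in>A. u \<in> K i \<longrightarrow> f (x + u) = f x + g i u + H i u"
  proof (intro eventually_ball_finite finA ballI)
    fix i assume i: "i \<in> A"
    show "\<forall>\<^sub>F u in nhds 0. u \<in> K i \<longrightarrow> f (x + u) = f x + g i u + H i u"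
      using K(3)[OF i] by eventually_elim
        (use A[OF i] fq quadratic_taylor[OF quad] in \<open>auto simp: g_def H_def\<close>)
  qed
  \<comment> \<open>An inactive piece is closed and misses \<open>x\<close>, hence also a
    neighbourhood of \<open>x\<close>. Near \<open>x\<close> the active pieces do all the
    covering.\<close>
  have ev_cover: "\<forall>\<^sub>F u in nhds 0. u \<in> (\<Union>i\<in>A. K i)"
  proof -
    have "\<forall>\<^sub>F u in nhds 0. \<forall>i\<in>{1..I}. x + u \<in> P i \<longrightarrow> i \<in> A \<and> u \<in> K i"
    proof (intro eventually_ball_finite ballI finite_atLeastAtMost)
      fix i assume i: "i \<in> {1..I}"
      show "\<forall>\<^sub>F u in nhds 0. x + u \<in> P i \<longrightarrow> i \<in> A \<and> u \<in> K i"
      proof (cases "i \<in> A")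
        case True
        then show ?thesis using K(3)[OF True] by (auto elim: eventually_mono)
      next
        case False
        have "((\<lambda>u. x + u) \<longlongrightarrow> x + 0) (nhds 0)" by (intro tendsto_intros filterlim_ident)
        moreover have "open (- P i)" using poly[OF i] polyhedron_imp_closed by blast
        moreover have "x \<in> - P i" using False i by (simp add: A_def active_pieces_def)
        ultimately have "\<forall>\<^sub>F u in nhds 0. x + u \<in> - P i" by (auto dest: topological_tendstoD)
        then show ?thesis by (auto elim: eventually_mono)
      qed
    qed
    then show ?thesis by eventually_elim (use cover in blast)
  qed
  \<comment> \<open>A short multiple of \<open>v\<close> lies in some active cone; rescaling turns
    the local cover into a global one.\<close>
  have cov: "\<exists>i\<in>A. v \<in> K i" for v
  proof -
    obtain t where "t > 0" "t *\<^sub>R v \<in> (\<Union>i\<in>A. K i)"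
      using eventually_at_right_0_witness[OF eventually_nhds_0_ray[OF ev_cover, of v]] .
    then show ?thesis using K(2) cone_iff_ray by blast
  qed
  have agree: "g i v = g j v \<and> H i v = H j v"
    if "i \<in> A" "j \<in> A" "v \<in> K i" "v \<in> K j" for i j v
  proof -
    have "\<forall>\<^sub>F t in at_right 0. t * g i v + t\<^sup>2 * H i v = t * g j v + t\<^sup>2 * H j v"
      using eventually_nhds_0_ray[OF ev_q, of v] eventually_at_right_less[of 0]
    proof eventually_elim
      case (elim t)
      then have "t *\<^sub>R v \<in> K i" "t *\<^sub>R v \<in> K j" using that K(2) by (simp_all add: cone_iff_ray)
      then have "g i (t *\<^sub>R v) + H i (t *\<^sub>R v) = g j (t *\<^sub>R v) + H j (t *\<^sub>R v)"
        using elim(1)[rule_format, OF that(1)] elim(1)[rule_format, OF that(2)] by simp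
      then show ?case using lq that(1,2) elim(2) by (simp add: lq_expansion_def)
    qed
    then show ?thesis using lq_coefficients_unique by blast
  qed
  \<comment> \<open>The piece chosen for each direction is arbitrary; \<open>agree\<close> makes the
    glued values independent of the choice.\<close>
  obtain \<iota> where "\<forall>v. \<iota> v \<in> A \<and> v \<in> K (\<iota> v)"
    using cov choice[of "\<lambda>v i. i \<in> A \<and> v \<in> K i"] by blast
  then have \<iota>: "\<And>v. \<iota> v \<in> A" "\<And>v. v \<in> K (\<iota> v)" by auto
  define h where "h = (\<lambda>v. g (\<iota> v) v)"
  define Q where "Q = (\<lambda>v. H (\<iota> v) v)"
  have hQ: "h v = g i v" "Q v = H i v" if "i \<in> A" "v \<in> K i" for i v
    using agree[OF \<iota>(1) that(1) \<iota>(2) that(2)] by (auto simp: h_def Q_def)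
  have K_UNIV: "(\<Union>i\<in>A. K i) = UNIV" using cov by blast
  have cont: "continuous_on (K i) (g i)" "continuous_on (K i) (H i)" if "i \<in> A" for i
    using lq[OF that] unfolding lq_expansion_def by (auto intro: continuous_on_subset)
  have "continuous_on (\<Union>i\<in>A. K i) h"
    by (intro continuous_on_closed_Union finA K(1))
      (use hQ cont in \<open>auto cong: continuous_on_cong\<close>)
  moreover have "continuous_on (\<Union>i\<in>A. K i) Q"
    by (intro continuous_on_closed_Union finA K(1))
      (use hQ cont in \<open>auto cong: continuous_on_cong\<close>)
  moreover have "h (t *\<^sub>R v) = t * h v" "Q (t *\<^sub>R v) = t\<^sup>2 * Q v" if "t > 0" for t v
  proof -
    have "t *\<^sub>R v \<in> K (\<iota> v)" using \<iota> K(2) that by (simp add: cone_iff_ray)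
    then show "h (t *\<^sub>R v) = t * h v" "Q (t *\<^sub>R v) = t\<^sup>2 * Q v"
      using hQ[OF \<iota>(1), of "t *\<^sub>R v" v] lq[OF \<iota>(1), of v] that
      by (simp_all add: lq_expansion_def h_def Q_def)
  qed
  moreover have "\<forall>\<^sub>F u in nhds 0. f (x + u) = f x + h u + Q u"
    using ev_q by eventually_elim (use \<iota> h_def Q_def in blast)
  ultimately have "lq_expansion f x h Q" unfolding lq_expansion_def K_UNIV by blast
  moreover have "\<forall>i\<in>A. \<forall>v\<in>K i. h v = g i v \<and> Q v = H i v" using hQ by blast
  ultimately show thesis using cov that unfolding A_def K_def g_def H_def by blast
qed

section \<open>The second-order condition and quadratic growth\<close>

text \<open>Phrased through the coefficients rather than through a function, so that one condition
  serves both \<open>f\<close> and the individual \<open>q i\<close>.\<close>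

definition second_order_sufficient ::
  "('a::real_normed_vector \<Rightarrow> real) \<Rightarrow> ('a \<Rightarrow> real) \<Rightarrow> 'a set \<Rightarrow> bool" where
  "second_order_sufficient h Q T \<longleftrightarrow>
     (\<forall>v\<in>T. h v \<ge> 0) \<and> (\<forall>v\<in>T. v \<noteq> 0 \<and> h v = 0 \<longrightarrow> Q v > 0)"

text \<open>On the unit vectors of \<open>T\<close> the function \<open>max (h v) (Q v)\<close> is
  positive, so by compactness it has a positive minimum \<open>m\<close>. Writing \<open>u\<close>
  as \<open>t\<close> times a unit vector \<open>v\<close>, the value is
  \<open>t * (h v + t * Q v)\<close>: either \<open>Q v\<close> is at least \<open>m\<close>, or
  \<open>h v\<close> is and outweighs \<open>t * Q v\<close> for small \<open>t\<close>.\<close>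

lemma quadratic_growth_on_cone:
  fixes h Q :: "'a::euclidean_space \<Rightarrow> real"
  assumes lq: "lq_expansion f x h Q" and T: "closed T" "cone T"
    and sosc: "second_order_sufficient h Q T"
  shows "\<exists>c>0. \<forall>\<^sub>F u in nhds 0. u \<in> T \<longrightarrow> h u + Q u \<ge> c * (norm u)\<^sup>2"
proof -
  let ?S = "T \<inter> sphere 0 1"
  have comp: "compact ?S" using T(1) by (intro closed_Int_compact) auto
  have cont: "continuous_on ?S h" "continuous_on ?S Q"
    using lq unfolding lq_expansion_def by (auto intro: continuous_on_subset)
  show ?thesis
  proof (cases "?S = {}")
    \<comment> \<open>The cone contains no nonzero vector, so any positive constant would
      do.\<close>
    case True
    have "u = 0" if "u \<in> T" for u
    proof (rule ccontr)
      assume "u \<noteq> 0"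
      then have "(1 / norm u) *\<^sub>R u \<in> ?S" using that T(2) by (simp add: cone_iff_ray)
      with True show False by blast
    qed
    then have "\<forall>u. u \<in> T \<longrightarrow> h u + Q u \<ge> 1 * (norm u)\<^sup>2"
      using lq_expansion_zero[OF lq] by force
    then show ?thesis by (intro exI[of _ 1]) simp
  next
    case False
    have "continuous_on ?S (\<lambda>v. max (h v) (Q v))" using cont by (intro continuous_intros)
    then obtain v0 where v0: "v0 \<in> ?S" "\<And>v. v \<in> ?S \<Longrightarrow> max (h v0) (Q v0) \<le> max (h v) (Q v)"
      using continuous_attains_inf[OF comp False] by blast
    define m where "m = max (h v0) (Q v0)"
    have "v0 \<in> T" "v0 \<noteq> 0" using v0(1) by auto
    then have "h v0 > 0 \<or> Q v0 > 0" using sosc unfolding second_order_sufficient_def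
      by fastforce
    then have m: "m > 0" by (auto simp: m_def)
    obtain w where w: "w \<in> ?S" "\<And>v. v \<in> ?S \<Longrightarrow> Q w \<le> Q v"
      using continuous_attains_inf[OF comp False cont(2)] by blast
    define M where "M = \<bar>Q w\<bar> + 1"
    have M: "M > 0" "\<And>v. v \<in> ?S \<Longrightarrow> Q v \<ge> - M"
      using w(2) unfolding M_def by fastforce+
    \<comment> \<open>The threshold is chosen such that \<open>m - t * M \<ge> m * t\<close>, where
      \<open>- M\<close> bounds \<open>Q\<close> from below on the unit vectors.\<close>
    have bound: "h v + t * Q v \<ge> m * t" if v: "v \<in> ?S" and t: "0 < t" "t \<le> m / (M + m)" for v t
    proof (cases "Q v \<ge> m")
      case True
      have "h v \<ge> 0" using sosc v unfolding second_order_sufficient_def by blast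
      moreover have "t * Q v \<ge> t * m" using True t(1) by (intro mult_left_mono) auto
      ultimately show ?thesis by (simp add: mult.commute)
    next
      case False
      then have "h v \<ge> m" using v0(2)[OF v] by (auto simp: m_def)
      moreover have "t * Q v \<ge> t * (- M)" using M(2)[OF v] t(1) by (intro mult_left_mono) auto
      moreover have "t * (M + m) \<le> m" using t(2) m M(1) by (simp add: pos_le_divide_eq)
      ultimately show ?thesis by (simp add: algebra_simps)
    qed
    have "\<forall>\<^sub>F u::'a in nhds 0. norm u < m / (M + m)"
      using m M(1) by (intro order_tendstoD[OF tendsto_norm[OF filterlim_ident]]) simp
    then have "\<forall>\<^sub>F u in nhds 0. u \<in> T \<longrightarrow> h u + Q u \<ge> m * (norm u)\<^sup>2"
    proof (eventually_elim, intro impI)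
      fix u assume u: "norm u < m / (M + m)" "u \<in> T"
      show "h u + Q u \<ge> m * (norm u)\<^sup>2"
      proof (cases "u = 0")
        case True
        then show ?thesis using lq_expansion_zero[OF lq] by simp
      next
        case False
        define t v where "t = norm u" and "v = (1 / norm u) *\<^sub>R u"
        have t: "t > 0" and uv: "u = t *\<^sub>R v" using False by (auto simp: t_def v_def)
        have "v \<in> ?S" using False u(2) T(2) by (simp add: v_def cone_iff_ray)
        then have "t * (h v + t * Q v) \<ge> t * (m * t)"
          using t u(1) by (intro mult_left_mono bound) (auto simp: t_def)
        then show ?thesis using lq t unfolding uv lq_expansion_def
          by (simp add: \<open>v \<in> ?S\<close>[THEN IntD2, simplified] power2_eq_square algebra_simps)
      qed
    qed
    then show ?thesis using m by blast
  qed
qed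

section \<open>Comparison of minimizers and first-order conditions\<close>

lemma strict_local_minimizer_if_strong:
  assumes "strong_local_minimizer f X x"
  shows "strict_local_minimizer f X x"
proof -
  obtain c N where "x \<in> X" "c > 0" "open N" "x \<in> N"
    and growth: "\<And>y. y \<in> X \<inter> N \<Longrightarrow> f y \<ge> f x + c * (norm (y - x))\<^sup>2"
    using assms unfolding strong_local_minimizer_def by blast
  moreover have "f y > f x" if "y \<in> X \<inter> N" "y \<noteq> x" for y
  proof -
    have "c * (norm (y - x))\<^sup>2 > 0" using \<open>c > 0\<close> that(2) by simp
    then show ?thesis using growth[OF that(1)] by linarith
  qed
  ultimately show ?thesis unfolding strict_local_minimizer_def by blast
qed

lemma local_minimizer_if_strict:
  assumes "strict_local_minimizer f X x"
  shows "local_minimizer f X x"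
proof -
  obtain N where N: "x \<in> X" "open N" "x \<in> N" "\<And>y. y \<in> X \<inter> N \<Longrightarrow> y \<noteq> x \<Longrightarrow> f y > f x"
    using assms unfolding strict_local_minimizer_def by blast
  have "f y \<ge> f x" if "y \<in> X \<inter> N" for y
    using N(4)[OF that] by (cases "y = x") auto
  then show ?thesis unfolding local_minimizer_def using N(1-3) by blast
qed

lemma eventually_nhds_translate:
  fixes z :: "'a::real_normed_vector"
  assumes "\<forall>\<^sub>F u in nhds 0. R (z + u)"
  shows "\<forall>\<^sub>F y in nhds z. R y"
proof -
  have "((\<lambda>y. y - z) \<longlongrightarrow> z - z) (nhds z)" by (intro tendsto_intros filterlim_ident)
  then have "filterlim (\<lambda>y. y - z) (nhds 0) (nhds z)" by simp
  with assms have "\<forall>\<^sub>F y in nhds z. R (z + (y - z))" by (rule eventually_compose_filterlim)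
  then show ?thesis by simp
qed

lemma eventually_ray_minimizer:
  fixes X :: "'a::euclidean_space set"
  assumes "polyhedron X" "x \<in> X" "v \<in> tangent_cone x X" "open N" "x \<in> N"
  shows "\<forall>\<^sub>F t in at_right 0. x + t *\<^sub>R v \<in> X \<inter> N"
proof -
  have "((\<lambda>t. x + t *\<^sub>R v) \<longlongrightarrow> x + 0 *\<^sub>R v) (at_right 0)" by (intro tendsto_intros)
  then have "\<forall>\<^sub>F t in at_right 0. x + t *\<^sub>R v \<in> N"
    using assms(4,5) by (auto dest: topological_tendstoD)
  then show ?thesis
    using eventually_ray_in_polyhedron[OF assms(1-3)] by eventually_elim simp
qed

lemma first_order_necessary:
  fixes X :: "'a::euclidean_space set"
  assumes "lq_expansion f x h Q" "polyhedron X" "local_minimizer f X x" "v \<in> tangent_cone x X"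
  shows "h v \<ge> 0"
proof -
  obtain N where N: "x \<in> X" "open N" "x \<in> N" "\<And>y. y \<in> X \<inter> N \<Longrightarrow> f y \<ge> f x"
    using assms(3) unfolding local_minimizer_def by blast
  have lim: "((\<lambda>\<tau>. (f (x + \<tau> *\<^sub>R v) - f x) / \<tau>) \<longlongrightarrow> h v) (at_right 0)"
    using has_dir_derivative_lq[OF assms(1)] unfolding has_dir_derivative_def .
  have "\<forall>\<^sub>F \<tau> in at_right 0. 0 \<le> (f (x + \<tau> *\<^sub>R v) - f x) / \<tau>"
    using eventually_ray_minimizer[OF assms(2) N(1) assms(4) N(2,3)] eventually_at_right_less[of 0]
    by eventually_elim (use N(4) in auto)
  then show ?thesis by (rule tendsto_lowerbound[OF lim]) simp
qed

lemma stationary_point_if_local_minimizer: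
  fixes X :: "'a::euclidean_space set"
  assumes "\<And>y. \<exists>h Q. lq_expansion f y h Q" "polyhedron X" "local_minimizer f X x"
  shows "stationary_point f X x"
proof -
  obtain h Q where lq: "lq_expansion f x h Q" using assms(1) by blast
  have "x \<in> X" using assms(3) by (simp add: local_minimizer_def)
  then show ?thesis unfolding stationary_point_def
    using has_dir_derivative_lq[OF lq] first_order_necessary[OF lq assms(2,3)] by blast
qed

text \<open>One-sided limits are unique, so the derivative whose existence
  \<open>stationary_point\<close> demands can only be \<open>h v\<close>.\<close>

lemma stationary_point_lq_iff:
  fixes x :: "'a::euclidean_space"
  assumes "lq_expansion f x h Q" "x \<in> X"
  shows "stationary_point f X x \<longleftrightarrow> (\<forall>v\<in>tangent_cone x X. h v \<ge> 0)"
proof -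
  have "d = h v" if "has_dir_derivative f x v d" for v d
    using tendsto_unique[OF _ that[unfolded has_dir_derivative_def]
        has_dir_derivative_lq[OF assms(1), unfolded has_dir_derivative_def]] by simp
  then show ?thesis unfolding stationary_point_def
    using assms(2) has_dir_derivative_lq[OF assms(1)] by blast
qed

section \<open>Minimizers on a polyhedron characterized by the second-order condition\<close>

context
  fixes f :: "'a::euclidean_space \<Rightarrow> real" and X :: "'a set" and x :: 'a and h Q :: "'a \<Rightarrow> real"
  assumes lq_everywhere: "\<And>y. \<exists>h Q. lq_expansion f y h Q"
    and X: "polyhedron X" "x \<in> X"
    and lq: "lq_expansion f x h Q"
begin

text \<open>Along a tangent direction with \<open>h v = 0\<close> the increment of \<open>f\<close>
  is just \<open>t\<^sup>2 * Q v\<close>, which strictness forces to be positive.\<close>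

lemma second_order_sufficient_if_strict:
  assumes "strict_local_minimizer f X x"
  shows "second_order_sufficient h Q (tangent_cone x X)"
proof -
  obtain N where N: "open N" "x \<in> N" "\<And>y. y \<in> X \<inter> N \<Longrightarrow> y \<noteq> x \<Longrightarrow> f y > f x"
    using assms unfolding strict_local_minimizer_def by blast
  have "Q v > 0" if v: "v \<in> tangent_cone x X" "v \<noteq> 0" "h v = 0" for v
  proof -
    obtain t where "t > 0" "x + t *\<^sub>R v \<in> X \<inter> N" "f (x + t *\<^sub>R v) = f x + (t * h v + t\<^sup>2 * Q v)"
      using eventually_at_right_0_witness[OF eventually_conj[OF
            eventually_ray_minimizer[OF X v(1) N(1,2)] lq_expansion_ray[OF lq, of v]]] by blast
    moreover from this have "x + t *\<^sub>R v \<noteq> x" using v(2) by simp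
    moreover from calculation have "f (x + t *\<^sub>R v) > f x" using N(3) by blast
    ultimately show ?thesis using v(3) by (simp add: zero_less_mult_iff)
  qed
  then show ?thesis unfolding second_order_sufficient_def
    using first_order_necessary[OF lq X(1) local_minimizer_if_strict[OF assms]] by blast
qed

lemma strong_if_second_order_sufficient:
  assumes "second_order_sufficient h Q (tangent_cone x X)"
  shows "strong_local_minimizer f X x"
proof -
  obtain c where c: "c > 0"
    "\<forall>\<^sub>F u in nhds 0. u \<in> tangent_cone x X \<longrightarrow> h u + Q u \<ge> c * (norm u)\<^sup>2"
    using quadratic_growth_on_cone[OF lq closed_tangent_cone[OF X] cone_tangent_cone[OF X] assms]
    by blast
  have "\<forall>\<^sub>F u in nhds 0. f (x + u) = f x + h u + Q u"
    using lq unfolding lq_expansion_def by blast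
  then have "\<forall>\<^sub>F u in nhds 0. x + u \<in> X \<longrightarrow> f (x + u) \<ge> f x + c * (norm (x + u - x))\<^sup>2"
    using c(2) eventually_tangent_cone_iff[OF X] by eventually_elim auto
  then have "\<forall>\<^sub>F y in nhds x. y \<in> X \<longrightarrow> f y \<ge> f x + c * (norm (y - x))\<^sup>2"
    by (rule eventually_nhds_translate)
  then show ?thesis
    unfolding strong_local_minimizer_def eventually_nhds using X(2) c(1) by blast
qed

text \<open>At a nearby point \<open>x + u\<close> the derivative towards \<open>x\<close> is \<open>- (h u + 2 * Q u)\<close>, which
  by homogeneity equals \<open>- (h (2 u) + Q (2 u)) / 2\<close> and is negative by the growth bound.\<close>

lemma isolated_stationary_if_second_order_sufficient:
  assumes "second_order_sufficient h Q (tangent_cone x X)"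
  shows "isolated_stationary_point f X x"
proof -
  obtain c where c: "c > 0"
    "\<forall>\<^sub>F u in nhds 0. u \<in> tangent_cone x X \<longrightarrow> h u + Q u \<ge> c * (norm u)\<^sup>2"
    using quadratic_growth_on_cone[OF lq closed_tangent_cone[OF X] cone_tangent_cone[OF X] assms]
    by blast
  have lim2: "filterlim (\<lambda>u::'a. 2 *\<^sub>R u) (nhds 0) (nhds 0)"
    using tendsto_scaleR[OF tendsto_const filterlim_ident, of "2::real" "0::'a"] by simp
  have growth2: "\<forall>\<^sub>F u in nhds 0. 2 *\<^sub>R u \<in> tangent_cone x X \<longrightarrow>
      h (2 *\<^sub>R u) + Q (2 *\<^sub>R u) \<ge> c * (norm (2 *\<^sub>R u))\<^sup>2"
    using c(2) lim2 by (rule eventually_compose_filterlim)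
  have "\<forall>\<^sub>F u in nhds 0. f (x + u) = f x + h u + Q u"
    using lq unfolding lq_expansion_def by blast
  \<comment> \<open>A ball is taken because, with \<open>u\<close>, the whole segment from
    \<open>u\<close> to the origin has to stay in the region where the expansion holds.\<close>
  then obtain e where e: "e > 0" "\<And>u. norm u < e \<Longrightarrow> f (x + u) = f x + h u + Q u"
    unfolding eventually_nhds_metric by (auto simp: dist_norm)
  have small: "\<forall>\<^sub>F u::'a in nhds 0. norm u < e"
    using e(1) by (intro order_tendstoD[OF tendsto_norm[OF filterlim_ident]]) simp
  have "\<forall>\<^sub>F u in nhds 0. stationary_point f X (x + u) \<longrightarrow> x + u = x"
    using growth2 small
  proof eventually_elim
    case (elim u)
    note g = elim(1)
    show ?case
    proof (intro impI, rule ccontr)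
      assume st: "stationary_point f X (x + u)" and "x + u \<noteq> x"
      with elim(2) have u: "norm u < e" "x + u \<noteq> x" by auto
      have xu: "x + u \<in> X" using st by (simp add: stationary_point_def)
      have "u \<in> tangent_cone x X" using diff_in_tangent_cone[OF X xu] by simp
      then have "2 *\<^sub>R u \<in> tangent_cone x X" using cone_tangent_cone[OF X] by (simp add: cone_iff_ray)
      with g have "h (2 *\<^sub>R u) + Q (2 *\<^sub>R u) \<ge> c * (norm (2 *\<^sub>R u))\<^sup>2" by blast
      moreover have "h (2 *\<^sub>R u) + Q (2 *\<^sub>R u) = 2 * (h u + 2 * Q u)"
        using lq by (simp add: lq_expansion_def)
      moreover have "c * (norm (2 *\<^sub>R u))\<^sup>2 > 0" using u(2) c(1) by simp
      ultimately have "2 * (h u + 2 * Q u) > 0" by (metis less_le_trans)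
      then have pos: "h u + 2 * Q u > 0" by simp
      have "- u \<in> tangent_cone (x + u) X" using diff_in_tangent_cone[OF X(1) xu X(2)] by simp
      then obtain d where d: "d \<ge> 0" "has_dir_derivative f (x + u) (- u) d"
        using st[unfolded stationary_point_def, THEN conjunct2, rule_format, of "- u"] by blast
      \<comment> \<open>The expansion at \<open>x\<close> also yields this derivative at
        \<open>x + u\<close>: the points \<open>x + u + t *\<^sub>R (- u)\<close> lie on the ray
        from \<open>x\<close> through \<open>x + u\<close>, where \<open>h\<close> and
        \<open>Q\<close> scale by \<open>1 - t\<close> and its square.\<close>
      have "((\<lambda>t. - (h u + 2 * Q u) + t * Q u) \<longlongrightarrow> - (h u + 2 * Q u) + 0 * Q u) (at_right 0)"
        by (intro tendsto_intros)
      moreover have "\<forall>\<^sub>F t in at_right 0. - (h u + 2 * Q u) + t * Q u =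
          (f (x + u + t *\<^sub>R (- u)) - f (x + u)) / t"
      proof -
        have "\<forall>\<^sub>F t in at_right (0::real). t < 1"
          by (rule order_tendstoD(2)[OF tendsto_ident_at]) simp
        then show ?thesis using eventually_at_right_less[of 0]
        proof eventually_elim
          case (elim t)
          then have "(1 - t) * norm u \<le> 1 * norm u" by (intro mult_right_mono) auto
          then have "norm ((1 - t) *\<^sub>R u) < e" using u(1) elim by simp
          then have "f (x + (1 - t) *\<^sub>R u) = f x + h ((1 - t) *\<^sub>R u) + Q ((1 - t) *\<^sub>R u)" by (rule e(2))
          moreover have "x + u + t *\<^sub>R (- u) = x + (1 - t) *\<^sub>R u" by (simp add: algebra_simps)
          moreover have "h ((1 - t) *\<^sub>R u) = (1 - t) * h u" "Q ((1 - t) *\<^sub>R u) = (1 - t)\<^sup>2 * Q u"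
            using lq elim by (simp_all add: lq_expansion_def)
          ultimately have "f (x + u + t *\<^sub>R (- u)) - f (x + u) = t * (- (h u + 2 * Q u) + t * Q u)"
            using e(2)[OF u(1)] by (simp add: power2_eq_square algebra_simps)
          then show ?case using elim by simp
        qed
      qed
      ultimately have "((\<lambda>t. (f (x + u + t *\<^sub>R (- u)) - f (x + u)) / t) \<longlongrightarrow>
          - (h u + 2 * Q u) + 0 * Q u) (at_right 0)"
        by (rule Lim_transform_eventually)
      then have "d = - (h u + 2 * Q u) + 0 * Q u"
        using d(2) unfolding has_dir_derivative_def by (intro tendsto_unique[of "at_right 0"]) auto
      with d(1) pos show False by simp
    qed
  qed
  then have "\<forall>\<^sub>F y in nhds x. stationary_point f X y \<longrightarrow> y = x"
    by (rule eventually_nhds_translate)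
  moreover have "stationary_point f X x"
    using assms unfolding second_order_sufficient_def stationary_point_lq_iff[OF lq X(2)] by blast
  ultimately show ?thesis unfolding isolated_stationary_point_def eventually_nhds by blast
qed

text \<open>Local minimizers are stationary, so a neighbourhood free of other stationary points is
  free of other local minimizers. The points involved differ from \<open>x\<close>, which is where
  \<open>lq_everywhere\<close> enters.\<close>

lemma isolated_local_minimizer_if_isolated_stationary:
  assumes "isolated_stationary_point f X x" "local_minimizer f X x"
  shows "isolated_local_minimizer f X x"
proof -
  obtain N where "open N" "x \<in> N" "\<And>y. y \<in> N \<Longrightarrow> stationary_point f X y \<Longrightarrow> y = x"
    using assms(1) unfolding isolated_stationary_point_def by blast
  moreover have "stationary_point f X y" if "local_minimizer f X y" for y
    using lq_everywhere X(1) that by (rule stationary_point_if_local_minimizer)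
  ultimately show ?thesis
    unfolding isolated_local_minimizer_def using assms(2) by blast
qed

text \<open>If the second-order condition failed along \<open>v\<close>, the function would be constant on a
  segment from \<open>x\<close> in direction \<open>v\<close>, and that segment would consist of local minimizers.\<close>

lemma second_order_sufficient_if_isolated_local_minimizer:
  assumes "isolated_local_minimizer f X x"
  shows "second_order_sufficient h Q (tangent_cone x X)"
proof -
  have min: "local_minimizer f X x"
    using assms by (simp add: isolated_local_minimizer_def)
  then obtain N where N: "open N" "x \<in> N" "\<And>y. y \<in> X \<inter> N \<Longrightarrow> f y \<ge> f x"
    unfolding local_minimizer_def by blast
  obtain N' where N': "open N'" "x \<in> N'" "\<And>y. y \<in> N' \<Longrightarrow> local_minimizer f X y \<Longrightarrow> y = x"
    using assms unfolding isolated_local_minimizer_def by blast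
  have "Q v > 0" if v: "v \<in> tangent_cone x X" "v \<noteq> 0" "h v = 0" for v
  proof (rule ccontr)
    assume nonpos: "\<not> Q v > 0"
    obtain t where t: "t > 0" "x + t *\<^sub>R v \<in> X \<inter> (N \<inter> N')"
      "f (x + t *\<^sub>R v) = f x + (t * h v + t\<^sup>2 * Q v)"
      using eventually_at_right_0_witness[OF eventually_conj[OF
            eventually_ray_minimizer[OF X v(1), of "N \<inter> N'"] lq_expansion_ray[OF lq, of v]]]
        N(1,2) N'(1,2) by blast
    have "t\<^sup>2 * Q v \<le> 0" using nonpos by (intro mult_nonneg_nonpos) auto
    then have "f (x + t *\<^sub>R v) \<le> f x" using t(3) v(3) by simp
    \<comment> \<open>On \<open>N\<close> the value \<open>f x\<close> is a lower bound, and the new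
      point does not exceed it, so the same \<open>N\<close> witnesses its minimality.\<close>
    then have "local_minimizer f X (x + t *\<^sub>R v)"
      unfolding local_minimizer_def using t(2) N by (intro conjI exI[of _ N]) force+
    then have "x + t *\<^sub>R v = x" using N'(3) t(2) by blast
    then show False using t(1) v(2) by simp
  qed
  then show ?thesis unfolding second_order_sufficient_def
    using first_order_necessary[OF lq X(1) min] by blast
qed

text \<open>Two cycles meet in the second-order condition: one through strong and strict minimizers,
  the other through isolated stationary points that are local minimizers and then isolated local
  minimizers.\<close>

lemma minimizer_iff_second_order_sufficient:
  shows "strong_local_minimizer f X x \<longleftrightarrow> second_order_sufficient h Q (tangent_cone x X)"
    and "strict_local_minimizer f X x \<longleftrightarrow> second_order_sufficient h Q (tangent_cone x X)"
    and "isolated_local_minimizer f X x \<longleftrightarrow> second_order_sufficient h Q (tangent_cone x X)"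
    and "isolated_stationary_point f X x \<and> local_minimizer f X x \<longleftrightarrow>
      second_order_sufficient h Q (tangent_cone x X)"
proof -
  let ?c = "second_order_sufficient h Q (tangent_cone x X)"
  have sosc: "strong_local_minimizer f X x" "strict_local_minimizer f X x"
    "isolated_stationary_point f X x" "local_minimizer f X x" if ?c
    using strong_if_second_order_sufficient[OF that] strict_local_minimizer_if_strong
      isolated_stationary_if_second_order_sufficient[OF that] local_minimizer_if_strict by blast+
  show "strong_local_minimizer f X x \<longleftrightarrow> ?c"
    using sosc(1) strict_local_minimizer_if_strong second_order_sufficient_if_strict by metis
  show "strict_local_minimizer f X x \<longleftrightarrow> ?c"
    using sosc(2) second_order_sufficient_if_strict by metis
  show "isolated_local_minimizer f X x \<longleftrightarrow> ?c"
    using sosc(3,4) isolated_local_minimizer_if_isolated_stationary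
      second_order_sufficient_if_isolated_local_minimizer by metis
  show "isolated_stationary_point f X x \<and> local_minimizer f X x \<longleftrightarrow> ?c"
    using sosc(3,4) isolated_local_minimizer_if_isolated_stationary
      second_order_sufficient_if_isolated_local_minimizer by metis
qed

text \<open>Feasible differences are tangent directions, and each tangent direction has a positive
  multiple that is a feasible difference. Homogeneity absorbs the factor.\<close>

lemma second_order_sufficient_iff_feasible:
  "second_order_sufficient h Q (tangent_cone x X) \<longleftrightarrow>
     (\<forall>y\<in>X. h (y - x) \<ge> 0) \<and> (\<forall>y\<in>X - {x}. h (y - x) = 0 \<longrightarrow> Q (y - x) > 0)"
  (is "_ \<longleftrightarrow> ?R")
proof
  assume "second_order_sufficient h Q (tangent_cone x X)"
  then show ?R using diff_in_tangent_cone[OF X] unfolding second_order_sufficient_def by auto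
next
  assume R: ?R
  have "h v \<ge> 0 \<and> (v \<noteq> 0 \<and> h v = 0 \<longrightarrow> Q v > 0)" if v: "v \<in> tangent_cone x X" for v
  proof -
    obtain t where t: "t > 0" "x + t *\<^sub>R v \<in> X"
      using eventually_at_right_0_witness[OF eventually_ray_in_polyhedron[OF X v]] .
    have hom: "h (x + t *\<^sub>R v - x) = t * h v" "Q (x + t *\<^sub>R v - x) = t\<^sup>2 * Q v"
      using lq t(1) by (simp_all add: lq_expansion_def)
    have "t * h v \<ge> 0" using R t(2) hom by metis
    moreover have "t\<^sup>2 * Q v > 0" if "v \<noteq> 0" "h v = 0"
    proof -
      have "x + t *\<^sub>R v \<in> X - {x}" using t that by simp
      then show ?thesis using R hom that by (metis mult_zero_right)
    qed
    ultimately show ?thesis using t(1) by (auto simp: zero_le_mult_iff zero_less_mult_iff)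
  qed
  then show "second_order_sufficient h Q (tangent_cone x X)"
    unfolding second_order_sufficient_def by blast
qed

end

section \<open>Assembling the equivalences\<close>

lemma all_equivalent_if_all_iff:
  assumes "\<And>p. p \<in> set ps \<Longrightarrow> p \<longleftrightarrow> c"
  shows "all_equivalent ps"
  unfolding all_equivalent_def
proof (intro ballI)
  fix p p' assume "p \<in> set ps" "p' \<in> set ps"
  then show "p \<longleftrightarrow> p'" using assms[of p] assms[of p'] by simp
qed

text \<open>The second conjunct compares \<open>f\<close> and \<open>q i\<close> on each piece
  separately, which the equivalence of the statements quantified over all active pieces would not
  give.\<close>

theorem theorem3:
  fixes f :: "real^'n \<Rightarrow> real"
    and P :: "nat \<Rightarrow> (real^'n) set"
    and q :: "nat \<Rightarrow> real^'n \<Rightarrow> real"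
    and I :: nat
    and X :: "(real^'n) set"
    and xbar :: "real^'n"
  assumes "PLQ_on UNIV f I P q"
    and "polyhedron X"
    and "xbar \<in> X"
  defines "A \<equiv> active_pieces I P xbar"
    and "Pt \<equiv> (\<lambda>i. X \<inter> P i)"
  shows
    "all_equivalent
      [strong_local_minimizer f X xbar,
       strict_local_minimizer f X xbar,
       isolated_local_minimizer f X xbar,
       isolated_stationary_point f X xbar \<and> local_minimizer f X xbar,

       \<forall>i\<in>A. strong_local_minimizer f (Pt i) xbar,
       \<forall>i\<in>A. strict_local_minimizer f (Pt i) xbar,
       \<forall>i\<in>A. isolated_local_minimizer f (Pt i) xbar,
       \<forall>i\<in>A. isolated_stationary_point f (Pt i) xbar \<and> local_minimizer f (Pt i) xbar,

       \<forall>i\<in>A. strong_local_minimizer (q i) (Pt i) xbar,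
       \<forall>i\<in>A. strict_local_minimizer (q i) (Pt i) xbar,
       \<forall>i\<in>A. isolated_local_minimizer (q i) (Pt i) xbar,
       \<forall>i\<in>A. isolated_stationary_point (q i) (Pt i) xbar \<and> local_minimizer (q i) (Pt i) xbar,

       (\<forall>x\<in>X. subderivative f xbar (x - xbar) \<ge> 0) \<and>
       (\<forall>x\<in>X - {xbar}. subderivative f xbar (x - xbar) = 0 \<longrightarrow>
                         second_subderivative f xbar (x - xbar) > 0),

       stationary_point f X xbar \<and>
       (\<forall>v\<in>tangent_cone xbar X. v \<noteq> 0 \<and> subderivative f xbar v = 0 \<longrightarrow>
                                  second_subderivative f xbar v > 0),

       (\<forall>v\<in>tangent_cone xbar X. subderivative f xbar v \<ge> 0) \<and>
       (\<forall>v\<in>tangent_cone xbar X. v \<noteq> 0 \<and> subderivative f xbar v = 0 \<longrightarrow>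
                                  second_subderivative f xbar v > 0),

       \<forall>i\<in>A. stationary_point (q i) (Pt i) xbar \<and>
              strictly_copositive_on (hessian (q i) xbar) (critical_cone xbar (q i) (Pt i))]
     \<and> (\<forall>i\<in>A.
          (strong_local_minimizer f (Pt i) xbar \<longleftrightarrow> strong_local_minimizer (q i) (Pt i) xbar) \<and>
          (strict_local_minimizer f (Pt i) xbar \<longleftrightarrow> strict_local_minimizer (q i) (Pt i) xbar) \<and>
          (isolated_local_minimizer f (Pt i) xbar \<longleftrightarrow> isolated_local_minimizer (q i) (Pt i) xbar) \<and>
          (isolated_stationary_point f (Pt i) xbar \<and> local_minimizer f (Pt i) xbar \<longleftrightarrow>
           isolated_stationary_point (q i) (Pt i) xbar \<and> local_minimizer (q i) (Pt i) xbar))"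
proof -
  let ?T = "tangent_cone xbar X"
  obtain h Q where lq: "lq_expansion f xbar h Q"
    and pieces: "\<forall>i\<in>A. \<forall>v\<in>tangent_cone xbar (P i).
       h v = gradient (q i) xbar \<bullet> v \<and> Q v = 1/2 * (v \<bullet> (hessian (q i) xbar *v v))"
    and cover: "\<forall>v. \<exists>i\<in>A. v \<in> tangent_cone xbar (P i)"
    using PLQ_lq_expansion[OF assms(1), of xbar, folded A_def] .
  define g where "g = (\<lambda>i v. gradient (q i) xbar \<bullet> v)"
  define H where "H = (\<lambda>i v. 1/2 * (v \<bullet> (hessian (q i) xbar *v v)))"
  let ?c = "second_order_sufficient h Q ?T"
  let ?ci = "\<lambda>i. second_order_sufficient h Q (tangent_cone xbar (Pt i))"
  have f_lq: "\<exists>h Q. lq_expansion f y h Q" for y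
    by (rule PLQ_lq_expansion[OF assms(1), of y]) blast
  have P: "polyhedron (P i)" "xbar \<in> P i" "quadratic_function (q i)" if "i \<in> A" for i
    using that assms(1) by (auto simp: A_def active_pieces_def PLQ_on_def)
  have Pt: "polyhedron (Pt i)" "xbar \<in> Pt i" if "i \<in> A" for i
    unfolding Pt_def using P[OF that] assms(2,3) by (auto intro: polyhedron_Int)
  have T_Pt: "tangent_cone xbar (Pt i) = ?T \<inter> tangent_cone xbar (P i)" if "i \<in> A" for i
    unfolding Pt_def using tangent_cone_Int_polyhedron[OF assms(2,3) P(1,2)[OF that]] .
  have q_lq: "\<exists>h Q. lq_expansion (q i) y h Q" if "i \<in> A" for i y
    using lq_expansion_quadratic[OF P(3)[OF that]] by blast
  have q_lq_xbar: "lq_expansion (q i) xbar (g i) (H i)" if "i \<in> A" for i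
    unfolding g_def H_def using lq_expansion_quadratic[OF P(3)[OF that]] .
  \<comment> \<open>On \<open>Pt i\<close> the functions \<open>f\<close> and \<open>q i\<close>
    have different expansions at \<open>xbar\<close>, but their coefficients coincide on the tangent
    cone, hence so do their second-order conditions.\<close>
  have same: "h v = g i v" "Q v = H i v" if "i \<in> A" "v \<in> tangent_cone xbar (Pt i)" for i v
    using pieces that T_Pt by (auto simp: g_def H_def)
  have ci_q: "second_order_sufficient (g i) (H i) (tangent_cone xbar (Pt i)) \<longleftrightarrow> ?ci i"
    if "i \<in> A" for i
    using same[OF that] unfolding second_order_sufficient_def by simp
  \<comment> \<open>The condition is pointwise in the direction, and the tangent cones of the sets
    \<open>Pt i\<close> have union \<open>?T\<close> by \<open>cover\<close> and
    \<open>T_Pt\<close>.\<close>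
  have c_iff: "(\<forall>i\<in>A. ?ci i) \<longleftrightarrow> ?c"
  proof
    assume "\<forall>i\<in>A. ?ci i"
    then show ?c using cover T_Pt unfolding second_order_sufficient_def by blast
  next
    assume ?c
    then show "\<forall>i\<in>A. ?ci i" using T_Pt unfolding second_order_sufficient_def by blast
  qed
  note fX = minimizer_iff_second_order_sufficient[OF f_lq assms(2,3) lq]
  have fPt: "strong_local_minimizer f (Pt i) xbar \<longleftrightarrow> ?ci i"
    "strict_local_minimizer f (Pt i) xbar \<longleftrightarrow> ?ci i"
    "isolated_local_minimizer f (Pt i) xbar \<longleftrightarrow> ?ci i"
    "isolated_stationary_point f (Pt i) xbar \<and> local_minimizer f (Pt i) xbar \<longleftrightarrow> ?ci i"
    if "i \<in> A" for i
    using minimizer_iff_second_order_sufficient[OF f_lq Pt[OF that] lq] by simp_all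
  have qPt: "strong_local_minimizer (q i) (Pt i) xbar \<longleftrightarrow> ?ci i"
    "strict_local_minimizer (q i) (Pt i) xbar \<longleftrightarrow> ?ci i"
    "isolated_local_minimizer (q i) (Pt i) xbar \<longleftrightarrow> ?ci i"
    "isolated_stationary_point (q i) (Pt i) xbar \<and> local_minimizer (q i) (Pt i) xbar \<longleftrightarrow> ?ci i"
    if "i \<in> A" for i
    using minimizer_iff_second_order_sufficient[OF q_lq[OF that] Pt[OF that] q_lq_xbar[OF that]]
      ci_q[OF that] by simp_all
  \<comment> \<open>Only signs matter, so the factor 2 in the second subderivative
    disappears.\<close>
  have sub: "subderivative f xbar v \<ge> 0 \<longleftrightarrow> h v \<ge> 0"
    "subderivative f xbar v = 0 \<longleftrightarrow> h v = 0"
    "second_subderivative f xbar v > 0 \<longleftrightarrow> Q v > 0" for v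
    by (simp_all add: subderivative_lq[OF lq] second_subderivative_lq[OF lq])
  have c: "(\<forall>x\<in>X. subderivative f xbar (x - xbar) \<ge> 0) \<and>
      (\<forall>x\<in>X - {xbar}. subderivative f xbar (x - xbar) = 0 \<longrightarrow>
         second_subderivative f xbar (x - xbar) > 0) \<longleftrightarrow> ?c"
    unfolding sub using second_order_sufficient_iff_feasible[OF f_lq assms(2,3) lq] by simp
  have d1: "stationary_point f X xbar \<and>
      (\<forall>v\<in>?T. v \<noteq> 0 \<and> subderivative f xbar v = 0 \<longrightarrow> second_subderivative f xbar v > 0) \<longleftrightarrow> ?c"
    "(\<forall>v\<in>?T. subderivative f xbar v \<ge> 0) \<and>
      (\<forall>v\<in>?T. v \<noteq> 0 \<and> subderivative f xbar v = 0 \<longrightarrow> second_subderivative f xbar v > 0) \<longleftrightarrow> ?c"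
    unfolding sub second_order_sufficient_def stationary_point_lq_iff[OF lq assms(3)] by simp_all
  \<comment> \<open>Strict copositivity includes symmetry of the Hessian, supplied by
    \<open>transpose_hessian_quadratic\<close>; the factor 1/2 in \<open>H\<close> leaves the sign
    unchanged.\<close>
  have d2: "stationary_point (q i) (Pt i) xbar \<and>
      strictly_copositive_on (hessian (q i) xbar) (critical_cone xbar (q i) (Pt i)) \<longleftrightarrow> ?ci i"
    if "i \<in> A" for i
    unfolding ci_q[OF that, symmetric]
    unfolding stationary_point_lq_iff[OF q_lq_xbar[OF that] Pt(2)[OF that]]
      second_order_sufficient_def strictly_copositive_on_def critical_cone_def
    using transpose_hessian_quadratic[OF P(3)[OF that], of xbar] by (auto simp: g_def H_def)
  show ?thesis
  proof (intro conjI ballI)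
    show "all_equivalent
      [strong_local_minimizer f X xbar,
       strict_local_minimizer f X xbar,
       isolated_local_minimizer f X xbar,
       isolated_stationary_point f X xbar \<and> local_minimizer f X xbar,
       \<forall>i\<in>A. strong_local_minimizer f (Pt i) xbar,
       \<forall>i\<in>A. strict_local_minimizer f (Pt i) xbar,
       \<forall>i\<in>A. isolated_local_minimizer f (Pt i) xbar,
       \<forall>i\<in>A. isolated_stationary_point f (Pt i) xbar \<and> local_minimizer f (Pt i) xbar,
       \<forall>i\<in>A. strong_local_minimizer (q i) (Pt i) xbar,
       \<forall>i\<in>A. strict_local_minimizer (q i) (Pt i) xbar,
       \<forall>i\<in>A. isolated_local_minimizer (q i) (Pt i) xbar,
       \<forall>i\<in>A. isolated_stationary_point (q i) (Pt i) xbar \<and> local_minimizer (q i) (Pt i) xbar,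
       (\<forall>x\<in>X. subderivative f xbar (x - xbar) \<ge> 0) \<and>
       (\<forall>x\<in>X - {xbar}. subderivative f xbar (x - xbar) = 0 \<longrightarrow>
                         second_subderivative f xbar (x - xbar) > 0),
       stationary_point f X xbar \<and>
       (\<forall>v\<in>?T. v \<noteq> 0 \<and> subderivative f xbar v = 0 \<longrightarrow> second_subderivative f xbar v > 0),
       (\<forall>v\<in>?T. subderivative f xbar v \<ge> 0) \<and>
       (\<forall>v\<in>?T. v \<noteq> 0 \<and> subderivative f xbar v = 0 \<longrightarrow> second_subderivative f xbar v > 0),
       \<forall>i\<in>A. stationary_point (q i) (Pt i) xbar \<and>
              strictly_copositive_on (hessian (q i) xbar) (critical_cone xbar (q i) (Pt i))]"
      unfolding fX c d1
      by (rule all_equivalent_if_all_iff[of _ ?c]) (auto simp: fPt qPt d2 c_iff)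
  qed (simp_all add: fPt qPt)
qed

end
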